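(* Let $m,n\ge1$ be integers, let $\omega\subset\mathbb{R}^m$ be nonempty and let $u:\omega\to\mathbb{R}^n$ be a Lipschitz function. Let $\Omega=\{(x,0)\in\mathbb{R}^m\times\mathbb{R}^n: x\in\omega\}$ and let $F$ be the 1-field on $\Omega\subset\mathbb{R}^{m+n}$ defined by $$f_{(x,0)}=0,\qquad D_{(x,0)}f=(0,u(x))\qquad (x\in\omega).$$ Let $G$ be any minimal Lipschitz extension of $F$ on $\mathbb{R}^{m+n}$, and define $\tilde u:\mathbb{R}^m\to\mathbb{R}^n$ by $$\tilde u(x)=(D_{(x,0)}g)^{(n)},\qquad x\in\mathbb{R}^m,$$ where for $y=(y^{(m)},y^{(n)})\in\mathbb{R}^m\times\mathbb{R}^n$, $y^{(n)}$ denotes the $\mathbb{R}^n$-component. Then $\tilde u$ is a minimal Lipschitz extension of $u$, i.e. $\tilde u=u$ on $\omega$ and $\mathrm{Lip}(\tilde u;\mathbb{R}^m)=\mathrm{Lip}(u;\omega)$.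
   Context: Euclidean spaces carry the standard scalar product and norm. A 1-field on a nonempty set $\Omega\subset\mathbb{R}^N$ is a map $F$ assigning to each $x\in \Omega$ the polynomial $F(x)(a)=f_x+\langle D_xf,a-x\rangle$ ($a\in\mathbb{R}^N$), where $f_x\in\mathbb{R}$ and $D_xf\in\mathbb{R}^N$ (a 1-field $G$ similarly has associated data $g_x$ and $D_xg$). For $x\ne y$ in $\Omega$, $$\Gamma^1(F;x,y)=2\sup_{a\in\mathbb{R}^N}\frac{|F(x)(a)-F(y)(a)|}{\|x-a\|^2+\|y-a\|^2},$$ and $\Gamma^1(F;\Omega)=\sup_{x\ne y\in \Omega}\Gamma^1(F;x,y)$. $\mathcal{F}^1(\Omega)$ is the set of 1-fields on $\Omega$ with $\Gamma^1(F;\Omega)<+\infty$. A minimal Lipschitz extension of $F\in\mathcal{F}^1(\Omega)$ on $\mathbb{R}^N$ is a $G\in\mathcal{F}^1(\mathbb{R}^N)$ with $G(x)=F(x)$ for $x\in\Omega$ and $\Gamma^1(G;\mathbb{R}^N)=\Gamma^1(F;\Omega)$. For a map $u$ on a set $S$, $\mathrm{Lip}(u;S)=\sup_{x\ne y\in S}\|u(x)-u(y)\|/\|x-y\|$; $u$ is Lipschitz if this is finite. A supremum over the empty set is taken to be $0$. *)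

theory Defs
  imports "HOL-Analysis.Analysis"
begin

text \<open>
  All suprema are taken in \<^typ>\<open>ennreal\<close>, so they always exist, and a supremum over
  the empty set is \<open>0\<close>.
  Maps on a subset of a Euclidean space are total functions of which only the values on that
  subset are ever used.
\<close>

definition taylor1 :: "real \<Rightarrow> 'a::euclidean_space \<Rightarrow> 'a \<Rightarrow> 'a \<Rightarrow> real"
  where "taylor1 c v x = (\<lambda>a. c + v \<bullet> (a - x))"

text \<open>The function \<open>f\<close> and the vector field \<open>D\<close> are the data
  \<open>f\<^sub>x\<close>, \<open>D\<^sub>xf\<close> associated with the 1-field \<open>F\<close>;
  on \<open>\<Omega>\<close> they are uniquely determined by \<open>F\<close>.\<close>

definition one_field_with ::
    "'a::euclidean_space set \<Rightarrow> ('a \<Rightarrow> 'a \<Rightarrow> real) \<Rightarrow> ('a \<Rightarrow> real) \<Rightarrow> ('a \<Rightarrow> 'a) \<Rightarrow> bool"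
  where "one_field_with \<Omega> F f D \<longleftrightarrow> (\<forall>x\<in>\<Omega>. F x = taylor1 (f x) (D x) x)"

definition Gamma1_at :: "('a::euclidean_space \<Rightarrow> 'a \<Rightarrow> real) \<Rightarrow> 'a \<Rightarrow> 'a \<Rightarrow> ennreal"
  where "Gamma1_at F x y =
    2 * (SUP a. ennreal (\<bar>F x a - F y a\<bar> / ((norm (x - a))\<^sup>2 + (norm (y - a))\<^sup>2)))"

definition Gamma1 :: "('a::euclidean_space \<Rightarrow> 'a \<Rightarrow> real) \<Rightarrow> 'a set \<Rightarrow> ennreal"
  where "Gamma1 F \<Omega> = Sup {Gamma1_at F x y | x y. x \<in> \<Omega> \<and> y \<in> \<Omega> \<and> x \<noteq> y}"

definition F1 :: "'a::euclidean_space set \<Rightarrow> ('a \<Rightarrow> 'a \<Rightarrow> real) set"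
  where "F1 \<Omega> = {F. (\<exists>f D. one_field_with \<Omega> F f D) \<and> Gamma1 F \<Omega> < top}"

definition minimal_field_extension ::
    "'a::euclidean_space set \<Rightarrow> ('a \<Rightarrow> 'a \<Rightarrow> real) \<Rightarrow> ('a \<Rightarrow> 'a \<Rightarrow> real) \<Rightarrow> bool"
  where "minimal_field_extension \<Omega> F G \<longleftrightarrow>
    G \<in> F1 UNIV \<and> (\<forall>x\<in>\<Omega>. G x = F x) \<and> Gamma1 G UNIV = Gamma1 F \<Omega>"

definition Lip :: "('a::euclidean_space \<Rightarrow> 'b::euclidean_space) \<Rightarrow> 'a set \<Rightarrow> ennreal"
  where "Lip u S = Sup {ennreal (norm (u x - u y) / norm (x - y)) | x y. x \<in> S \<and> y \<in> S \<and> x \<noteq> y}"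

definition minimal_map_extension ::
    "'a::euclidean_space set \<Rightarrow> ('a \<Rightarrow> 'b::euclidean_space) \<Rightarrow> ('a \<Rightarrow> 'b) \<Rightarrow> bool"
  where "minimal_map_extension S u v \<longleftrightarrow> (\<forall>x\<in>S. v x = u x) \<and> Lip v UNIV = Lip u S"

end

theory Submission
  imports Defs
begin

text \<open>
  The constants form a cycle of inequalities,
  \<open>Lip u_tilde \<le> \<Gamma>\<^sup>1(G) = \<Gamma>\<^sup>1(F) \<le> Lip u \<le> Lip u_tilde\<close>.

  For any two distinct points, \<open>\<Gamma>\<^sup>1\<close> controls the variation of the gradients:
  \<open>norm (D\<^sub>xg - D\<^sub>yg) / norm (x - y) \<le> \<Gamma>\<^sup>1(G; x, y)\<close>
  (lemma \<open>gradient_quotient_le_Gamma1_at\<close>). Restricting to the points \<open>(x, 0)\<close> and projecting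
  the gradient to the second factor only decreases the left-hand side, so
  \<open>Lip u_tilde \<le> \<Gamma>\<^sup>1(G)\<close>.

  For the field built from \<open>u\<close>, the function values vanish and the gradients are orthogonal to
  the subspace that contains the base points. The difference of the two polynomials at \<open>(a, b)\<close> is
  then \<open>(u x - u y) \<bullet> b\<close>, and the arithmetic-geometric mean inequality gives the reverse
  estimate \<open>\<Gamma>\<^sup>1(F; (x, 0), (y, 0)) \<le> norm (u x - u y) / norm (x - y)\<close>
  (lemma \<open>Gamma1_at_orthogonal_le\<close>). The equality in the cycle is the minimality of
  \<open>G\<close>, and the last inequality holds because \<open>u_tilde\<close> extends \<open>u\<close>: an affine polynomial
  determines its gradient, and \<open>G\<close> agrees with \<open>F\<close> over \<open>\<omega>\<close>.
\<close>

lemma taylor1_gradient_unique: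
  assumes "taylor1 c v x = taylor1 d w x"
  shows "v = w"
proof -
  have "c + v \<bullet> (a - x) = d + w \<bullet> (a - x)" for a
    using fun_cong[OF assms, of a] by (simp add: taylor1_def)
  from this[of x] this[of "x + (v - w)"] have "(v - w) \<bullet> (v - w) = 0"
    by (simp add: inner_diff_left)
  then show ?thesis by simp
qed

text \<open>
  The difference of the two polynomials is affine with gradient \<open>v - w\<close>; let \<open>s\<close> be its value at the
  midpoint of \<open>x\<close> and \<open>y\<close>. Moving from the midpoint by \<open>\<plusminus>e\<close>, with \<open>e\<close> parallel to \<open>v - w\<close>, it takes the
  values \<open>s \<plusminus> (v - w) \<bullet> e\<close>; whatever \<open>s\<close> is, one of them is at least
  \<open>(v - w) \<bullet> e\<close> in absolute value. The weight \<open>(norm (x - a))\<^sup>2 + (norm (y - a))\<^sup>2\<close> is the same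
  for both signs, by the parallelogram law.
\<close>

lemma gradient_quotient_attained:
  fixes x y v w :: "'a::euclidean_space"
  assumes "x \<noteq> y"
  shows "\<exists>a. norm (v - w) / norm (x - y) \<le>
    2 * (\<bar>taylor1 c v x a - taylor1 d w y a\<bar> / ((norm (x - a))\<^sup>2 + (norm (y - a))\<^sup>2))"
proof (cases "v = w")
  case True
  then show ?thesis by simp
next
  case False
  define r where "r = norm (x - y)"
  define h where "h = (1/2) *\<^sub>R (x - y)"
  define p where "p = y + h"
  \<comment> \<open>The length \<open>r / 2\<close> maximises \<open>t / (r\<^sup>2 / 2 + 2 * t\<^sup>2)\<close> over \<open>t\<close>.\<close>
  define e where "e = (r / (2 * norm (v - w))) *\<^sub>R (v - w)"
  define s where "s = taylor1 c v x p - taylor1 d w y p"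
  have r: "r > 0" using assms by (simp add: r_def)
  have nh: "norm h = r / 2" by (simp add: h_def r_def)
  have ne: "norm e = r / 2" using False r by (simp add: e_def)
  have xp: "x = p + h"
    using scaleR_half_double[of "x - y"] by (simp add: p_def h_def algebra_simps)
  have yp: "y = p - h" by (simp add: p_def)
  have weight: "(norm (x - (p + z)))\<^sup>2 + (norm (y - (p + z)))\<^sup>2 = r\<^sup>2" if "norm z = r / 2" for z
  proof -
    have "(norm (x - (p + z)))\<^sup>2 + (norm (y - (p + z)))\<^sup>2 = (norm (h - z))\<^sup>2 + (norm (h + z))\<^sup>2"
      using norm_minus_commute[of "- h" z] by (simp add: xp yp add.commute)
    also have "\<dots> = 2 * (norm h)\<^sup>2 + 2 * (norm z)\<^sup>2"
      by (simp add: power2_norm_eq_inner inner_diff inner_add inner_commute)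
    also have "\<dots> = r\<^sup>2" by (simp add: nh that power_divide)
    finally show ?thesis .
  qed
  have diff: "taylor1 c v x (p + z) - taylor1 d w y (p + z) = s + (v - w) \<bullet> z" for z
    by (simp add: taylor1_def s_def inner_simps)
  have De: "(v - w) \<bullet> e = r * norm (v - w) / 2"
    using False by (simp add: e_def dot_square_norm power2_eq_square)
  have "\<exists>z. norm z = r / 2 \<and> r * norm (v - w) / 2 \<le> \<bar>s + (v - w) \<bullet> z\<bar>"
  proof (cases "s \<ge> 0")
    case True
    then show ?thesis using ne De by (intro exI[of _ e]) auto
  next
    case False
    have "(v - w) \<bullet> (- e) = - (r * norm (v - w) / 2)" using De by (simp only: inner_minus_right)
    moreover have "0 \<le> r * norm (v - w) / 2" using r by simp
    ultimately show ?thesis using False ne by (intro exI[of _ "- e"]) auto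
  qed
  then obtain z where z: "norm z = r / 2" "r * norm (v - w) / 2 \<le> \<bar>s + (v - w) \<bullet> z\<bar>" by blast
  have "norm (v - w) / r = 2 * ((r * norm (v - w) / 2) / r\<^sup>2)"
    using r by (simp add: power2_eq_square)
  also have "\<dots> \<le> 2 * (\<bar>s + (v - w) \<bullet> z\<bar> / r\<^sup>2)"
    using z(2) by (intro mult_left_mono divide_right_mono) auto
  finally show ?thesis
    using diff[of z] weight[OF z(1)] by (intro exI[of _ "p + z"]) (simp add: r_def)
qed

lemma ennreal_double: "ennreal (2 * q) = 2 * ennreal q"
  by (simp add: ennreal_mult')

lemma gradient_quotient_le_Gamma1_at:
  assumes "G x = taylor1 c v x" "G y = taylor1 d w y" "x \<noteq> y"
  shows "ennreal (norm (v - w) / norm (x - y)) \<le> Gamma1_at G x y"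
proof -
  let ?q = "\<lambda>a. \<bar>G x a - G y a\<bar> / ((norm (x - a))\<^sup>2 + (norm (y - a))\<^sup>2)"
  obtain a where "norm (v - w) / norm (x - y) \<le> 2 * ?q a"
    using gradient_quotient_attained[OF assms(3)] assms(1,2) by metis
  then have "ennreal (norm (v - w) / norm (x - y)) \<le> ennreal (2 * ?q a)"
    by (rule ennreal_leI)
  also have "\<dots> = 2 * ennreal (?q a)" by (rule ennreal_double)
  also have "\<dots> \<le> Gamma1_at G x y"
    unfolding Gamma1_at_def by (intro mult_left_mono SUP_upper) auto
  finally show ?thesis .
qed

text \<open>
  By the parallelogram law \<open>r\<^sup>2 / 2 + 2 * t\<^sup>2\<close> is a lower bound of the denominator, where
  \<open>r = norm (x - y)\<close> and \<open>t = norm b\<close> is the distance of \<open>(a, b)\<close> from the first factor; and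
  \<open>r\<^sup>2 / 2 + 2 * t\<^sup>2 \<ge> 2 * r * t\<close>.
\<close>

lemma Gamma1_at_orthogonal_le:
  fixes x y :: "'a::euclidean_space" and v w :: "'b::euclidean_space"
  assumes "F (x, 0) = taylor1 0 (0, v) (x, 0)" "F (y, 0) = taylor1 0 (0, w) (y, 0)" "x \<noteq> y"
  shows "Gamma1_at F (x, 0) (y, 0) \<le> ennreal (norm (v - w) / norm (x - y))"
proof -
  let ?q = "\<lambda>c. \<bar>F (x, 0) c - F (y, 0) c\<bar> / ((norm ((x, 0) - c))\<^sup>2 + (norm ((y, 0) - c))\<^sup>2)"
  have q: "?q (a, b) \<le> norm (v - w) / norm (x - y) / 2" for a b
  proof -
    define r where "r = norm (x - y)"
    define t where "t = norm b"
    define M where "M = (norm (x - a))\<^sup>2 + (norm (y - a))\<^sup>2 + 2 * t\<^sup>2"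
    have r: "r > 0" using assms(3) by (simp add: r_def)
    have num: "\<bar>F (x, 0) (a, b) - F (y, 0) (a, b)\<bar> = \<bar>(v - w) \<bullet> b\<bar>"
      by (simp add: assms taylor1_def inner_diff_left)
    have den: "(norm ((x, 0) - (a, b)))\<^sup>2 + (norm ((y, 0) - (a, b)))\<^sup>2 = M"
      by (simp add: M_def t_def norm_Pair)
    have "r \<le> norm (x - a) + norm (y - a)"
      unfolding r_def using norm_triangle_ineq4[of "x - a" "y - a"] by simp
    then have "r\<^sup>2 \<le> (norm (x - a) + norm (y - a))\<^sup>2"
      using r by (intro power_mono) auto
    also have "\<dots> \<le> 2 * ((norm (x - a))\<^sup>2 + (norm (y - a))\<^sup>2)"
      using sum_squares_bound[of "norm (x - a)" "norm (y - a)"] by (simp add: power2_sum)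
    finally have "r\<^sup>2 / 2 + 2 * t\<^sup>2 \<le> M" by (simp add: M_def)
    moreover have "2 * r * t \<le> r\<^sup>2 / 2 + 2 * t\<^sup>2"
      using zero_le_power2[of "r - 2 * t"] by (simp add: power2_diff algebra_simps)
    ultimately have M: "2 * r * t \<le> M" by simp
    have "r\<^sup>2 / 2 + 2 * t\<^sup>2 > 0" using r by (simp add: add_pos_nonneg)
    then have Mpos: "M > 0" using \<open>r\<^sup>2 / 2 + 2 * t\<^sup>2 \<le> M\<close> by linarith
    have "\<bar>(v - w) \<bullet> b\<bar> * (2 * r) \<le> (norm (v - w) * t) * (2 * r)"
      using Cauchy_Schwarz_ineq2[of "v - w" b] r by (intro mult_right_mono) (auto simp: t_def)
    also have "\<dots> \<le> norm (v - w) * M"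
      using mult_left_mono[OF M, of "norm (v - w)"] by (simp add: mult_ac)
    finally have "\<bar>(v - w) \<bullet> b\<bar> / M \<le> norm (v - w) / (2 * r)"
      using r Mpos by (simp add: field_simps)
    then show ?thesis unfolding num den by (simp add: r_def mult.commute)
  qed
  have "(SUP c. ennreal (?q c)) \<le> ennreal (norm (v - w) / norm (x - y) / 2)"
  proof (intro SUP_least ennreal_leI)
    fix c :: "'a \<times> 'b"
    obtain a b where "c = (a, b)" by (rule prod.exhaust)
    then show "?q c \<le> norm (v - w) / norm (x - y) / 2" using q[of a b] by (simp only:)
  qed
  then have "Gamma1_at F (x, 0) (y, 0) \<le> 2 * ennreal (norm (v - w) / norm (x - y) / 2)"
    unfolding Gamma1_at_def by (intro mult_left_mono) auto
  also have "\<dots> = ennreal (2 * (norm (v - w) / norm (x - y) / 2))"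
    by (rule ennreal_double[symmetric])
  finally show ?thesis by simp
qed

lemma Lip_upper:
  assumes "x \<in> S" "y \<in> S" "x \<noteq> y"
  shows "ennreal (norm (u x - u y) / norm (x - y)) \<le> Lip u S"
  unfolding Lip_def using assms by (intro Sup_upper) blast

lemma Lip_least:
  assumes "\<And>x y. x \<in> S \<Longrightarrow> y \<in> S \<Longrightarrow> x \<noteq> y \<Longrightarrow> ennreal (norm (u x - u y) / norm (x - y)) \<le> K"
  shows "Lip u S \<le> K"
  unfolding Lip_def using assms by (intro Sup_least) blast

lemma Gamma1_upper:
  assumes "x \<in> \<Omega>" "y \<in> \<Omega>" "x \<noteq> y"
  shows "Gamma1_at F x y \<le> Gamma1 F \<Omega>"
  unfolding Gamma1_def using assms by (intro Sup_upper) blast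

lemma Gamma1_least:
  assumes "\<And>x y. x \<in> \<Omega> \<Longrightarrow> y \<in> \<Omega> \<Longrightarrow> x \<noteq> y \<Longrightarrow> Gamma1_at F x y \<le> K"
  shows "Gamma1 F \<Omega> \<le> K"
  unfolding Gamma1_def using assms by (intro Sup_least) blast

theorem theorem26:
  fixes \<omega> :: "(real ^ 'm) set"
    and u :: "real ^ 'm \<Rightarrow> real ^ 'n"
    and \<Omega> :: "((real ^ 'm) \<times> (real ^ 'n)) set"
    and F G :: "(real ^ 'm) \<times> (real ^ 'n) \<Rightarrow> (real ^ 'm) \<times> (real ^ 'n) \<Rightarrow> real"
    and f g :: "(real ^ 'm) \<times> (real ^ 'n) \<Rightarrow> real"
    and Df Dg :: "(real ^ 'm) \<times> (real ^ 'n) \<Rightarrow> (real ^ 'm) \<times> (real ^ 'n)"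
    and u_tilde :: "real ^ 'm \<Rightarrow> real ^ 'n"
  assumes "\<omega> \<noteq> {}"
    and "Lip u \<omega> < top"
    and "\<Omega> = {(x, 0) | x. x \<in> \<omega>}"
    and "one_field_with \<Omega> F f Df"
    and "\<And>x. x \<in> \<omega> \<Longrightarrow> f (x, 0) = 0"
    and "\<And>x. x \<in> \<omega> \<Longrightarrow> Df (x, 0) = (0, u x)"
    and "minimal_field_extension \<Omega> F G"
    and "one_field_with UNIV G g Dg"
    and "\<And>x. u_tilde x = snd (Dg (x, 0))"
  shows "minimal_map_extension \<omega> u u_tilde"
proof -
  have F: "F (x, 0) = taylor1 0 (0, u x) (x, 0)" if "x \<in> \<omega>" for x
    using assms(3-6) that unfolding one_field_with_def by auto
  have G: "G z = taylor1 (g z) (Dg z) z" for z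
    by (rule bspec[OF assms(8)[unfolded one_field_with_def] UNIV_I])
  have ext: "u_tilde x = u x" if "x \<in> \<omega>" for x
  proof -
    have "G (x, 0) = F (x, 0)"
      using assms(3,7) that unfolding minimal_field_extension_def by auto
    then have "taylor1 (g (x, 0)) (Dg (x, 0)) (x, 0) = taylor1 0 (0, u x) (x, 0)"
      using G[of "(x, 0)"] F[OF that] by (simp only:)
    then have "Dg (x, 0) = (0, u x)" by (rule taylor1_gradient_unique)
    then show ?thesis by (simp add: assms(9))
  qed
  have "Lip u_tilde UNIV \<le> Gamma1 G UNIV"
  proof (rule Lip_least)
    fix x y :: "real ^ 'm"
    assume "x \<noteq> y"
    then have ne: "(x, 0 :: real ^ 'n) \<noteq> (y, 0)" by simp
    have "norm (u_tilde x - u_tilde y) \<le> norm (Dg (x, 0) - Dg (y, 0))"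
      using norm_snd_le[of "snd (Dg (x, 0) - Dg (y, 0))" "fst (Dg (x, 0) - Dg (y, 0))"]
      unfolding prod.collapse by (simp add: assms(9))
    then have "ennreal (norm (u_tilde x - u_tilde y) / norm (x - y))
        \<le> ennreal (norm (Dg (x, 0) - Dg (y, 0)) / norm ((x, 0 :: real ^ 'n) - (y, 0)))"
      by (intro ennreal_leI) (simp add: norm_Pair divide_right_mono)
    also have "\<dots> \<le> Gamma1_at G (x, 0) (y, 0)"
      by (rule gradient_quotient_le_Gamma1_at[OF G G ne])
    also have "\<dots> \<le> Gamma1 G UNIV" using ne by (intro Gamma1_upper) auto
    finally show "ennreal (norm (u_tilde x - u_tilde y) / norm (x - y)) \<le> Gamma1 G UNIV" .
  qed
  also have "Gamma1 G UNIV = Gamma1 F \<Omega>"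
    using assms(7) by (simp add: minimal_field_extension_def)
  also have "Gamma1 F \<Omega> \<le> Lip u \<omega>"
  proof (rule Gamma1_least)
    fix z z'
    assume "z \<in> \<Omega>" "z' \<in> \<Omega>" "z \<noteq> z'"
    then obtain x y where xy: "z = (x, 0)" "z' = (y, 0)" "x \<in> \<omega>" "y \<in> \<omega>" "x \<noteq> y"
      using assms(3) by auto
    have "Gamma1_at F (x, 0) (y, 0) \<le> ennreal (norm (u x - u y) / norm (x - y))"
      using F xy by (intro Gamma1_at_orthogonal_le) auto
    also have "\<dots> \<le> Lip u \<omega>" using xy by (intro Lip_upper)
    finally show "Gamma1_at F z z' \<le> Lip u \<omega>" using xy by simp
  qed
  finally have "Lip u_tilde UNIV \<le> Lip u \<omega>" .
  moreover have "Lip u \<omega> \<le> Lip u_tilde UNIV"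
  proof (rule Lip_least)
    fix x y
    assume xy: "x \<in> \<omega>" "y \<in> \<omega>" "x \<noteq> y"
    show "ennreal (norm (u x - u y) / norm (x - y)) \<le> Lip u_tilde UNIV"
      using Lip_upper[of x UNIV y u_tilde] xy by (simp add: ext)
  qed
  ultimately show ?thesis
    using ext by (auto simp: minimal_map_extension_def)
qed

end
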